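(* Let $G$ be a finite group acting on a finite set $M$, and let $H$ and $H'$ be two orbit-maximal subgroups of $G$. Let $\mathcal{D}_H$ denote the $\mathcal{D}$-class of $\mathcal{FP}^+(G,M)$ containing the idempotent $\overline{H}$, and let $\hat{\mathcal{D}}_H=\mathcal{D}_H\cup\{0\}$ be its trace. (a) We have $\overline{H'}\in\mathcal{D}_H$ if and only if $H$ and $H'$ are conjugate in $G$. (b) The semigroup $\hat{\mathcal{D}}_H$ is an inverse semigroup.
   Context: The factorpower $\mathcal{FP}^+(G,M)$ of a finite group $G$ acting (on the left) on a finite set $M$ is the finite monoid whose elements are the classes $\overline{A}$ of nonempty subsets $A\subset G$ under the congruence $A\sim_M B$ iff $\{a(m)\mid a\in A\}=\{b(m)\mid b\in B\}$ for all $m\in M$, with multiplication $\overline{A}\,\overline{B}=\overline{AB}$, where $AB=\{ab\mid a\in A,b\in B\}$. Two subgroups of $G$ are orbit-equivalent if they have the same orbits on $M$. For a subgroup $H$ of $G$, the set of all subgroups orbit-equivalent to $H$ has a unique maximal element with respect to inclusion; subgroups arising as such maximal elements are called orbit-maximal. For an orbit-maximal subgroup $H$ the class $\overline{H}$ is an idempotent. The trace $\hat{\mathcal{D}}_H=\mathcal{D}_H\cup\{0\}$ is the semigroup with zero $0$ and multiplication $\pi\cdot\tau=\pi\tau$ if $\pi,\tau,\pi\tau\in\mathcal{D}_H$, and $\pi\cdot\tau=0$ otherwise. A semigroup is inverse if every element $a$ has a unique $b$ with $aba=a$, $bab=b$. *)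

theory Defs
  imports "HOL-Algebra.Group_Action"
begin

section \<open>The factorpower of a group action\<close>

definition nonempty_subsets :: "('g, 'c) monoid_scheme \<Rightarrow> 'g set set" where
  "nonempty_subsets G = {A. A \<subseteq> carrier G \<and> A \<noteq> {}}"

definition factor_rel ::
  "('g, 'c) monoid_scheme \<Rightarrow> 'm set \<Rightarrow> ('g \<Rightarrow> 'm \<Rightarrow> 'm) \<Rightarrow> ('g set \<times> 'g set) set" where
  "factor_rel G M \<phi> = {(A, B). A \<in> nonempty_subsets G \<and> B \<in> nonempty_subsets G \<and>
     (\<forall>m\<in>M. {\<phi> a m | a. a \<in> A} = {\<phi> b m | b. b \<in> B})}"

abbreviation factor_class ::
  "('g, 'c) monoid_scheme \<Rightarrow> 'm set \<Rightarrow> ('g \<Rightarrow> 'm \<Rightarrow> 'm) \<Rightarrow> 'g set \<Rightarrow> 'g set set" where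
  "factor_class G M \<phi> A \<equiv> factor_rel G M \<phi> `` {A}"

text \<open>The product of two classes is written as the union, over all representatives, of the class
  of the product set; by \<open>factor_class_mult\<close> below this is the class of the product of any
  representatives.\<close>

definition factorpower ::
  "('g, 'c) monoid_scheme \<Rightarrow> 'm set \<Rightarrow> ('g \<Rightarrow> 'm \<Rightarrow> 'm) \<Rightarrow> 'g set set monoid" where
  "factorpower G M \<phi> = \<lparr>
     carrier = nonempty_subsets G // factor_rel G M \<phi>,
     mult = (\<lambda>X Y. \<Union>A\<in>X. \<Union>B\<in>Y. factor_class G M \<phi> (A <#>\<^bsub>G\<^esub> B)),
     one = factor_class G M \<phi> {\<one>\<^bsub>G\<^esub>}\<rparr>"

section \<open>Orbit-maximal and conjugate subgroups\<close>

definition orbit_equivalent ::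
  "('g, 'c) monoid_scheme \<Rightarrow> 'm set \<Rightarrow> ('g \<Rightarrow> 'm \<Rightarrow> 'm) \<Rightarrow> 'g set \<Rightarrow> 'g set \<Rightarrow> bool" where
  "orbit_equivalent G M \<phi> H K \<longleftrightarrow>
     orbits (G\<lparr>carrier := H\<rparr>) M \<phi> = orbits (G\<lparr>carrier := K\<rparr>) M \<phi>"

definition orbit_maximal ::
  "('g, 'c) monoid_scheme \<Rightarrow> 'm set \<Rightarrow> ('g \<Rightarrow> 'm \<Rightarrow> 'm) \<Rightarrow> 'g set \<Rightarrow> bool" where
  "orbit_maximal G M \<phi> H \<longleftrightarrow> subgroup H G \<and>
     (\<forall>K. subgroup K G \<and> orbit_equivalent G M \<phi> H K \<and> H \<subseteq> K \<longrightarrow> K = H)"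

definition conjugate_subgroups ::
  "('g, 'c) monoid_scheme \<Rightarrow> 'g set \<Rightarrow> 'g set \<Rightarrow> bool" where
  "conjugate_subgroups G H K \<longleftrightarrow>
     (\<exists>g\<in>carrier G. K = g <#\<^bsub>G\<^esub> H #>\<^bsub>G\<^esub> (inv\<^bsub>G\<^esub> g))"

section \<open>Green's relations on a monoid\<close>

definition green_L :: "('a, 'c) monoid_scheme \<Rightarrow> ('a \<times> 'a) set" where
  "green_L S = {(a, b). a \<in> carrier S \<and> b \<in> carrier S \<and>
     {x \<otimes>\<^bsub>S\<^esub> a | x. x \<in> carrier S} = {x \<otimes>\<^bsub>S\<^esub> b | x. x \<in> carrier S}}"

definition green_R :: "('a, 'c) monoid_scheme \<Rightarrow> ('a \<times> 'a) set" where
  "green_R S = {(a, b). a \<in> carrier S \<and> b \<in> carrier S \<and>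
     {a \<otimes>\<^bsub>S\<^esub> x | x. x \<in> carrier S} = {b \<otimes>\<^bsub>S\<^esub> x | x. x \<in> carrier S}}"

definition green_D :: "('a, 'c) monoid_scheme \<Rightarrow> ('a \<times> 'a) set" where
  "green_D S = green_L S O green_R S"

definition D_class :: "('a, 'c) monoid_scheme \<Rightarrow> 'a \<Rightarrow> 'a set" where
  "D_class S a = green_D S `` {a}"

section \<open>Traces and inverse semigroups\<close>

text \<open>The adjoined zero is \<open>None\<close>.\<close>

definition trace_carrier :: "'a set \<Rightarrow> 'a option set" where
  "trace_carrier D = insert None (Some ` D)"

definition trace_mult ::
  "('a, 'c) monoid_scheme \<Rightarrow> 'a set \<Rightarrow> 'a option \<Rightarrow> 'a option \<Rightarrow> 'a option" where
  "trace_mult S D x y = (case (x, y) of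
      (Some a, Some b) \<Rightarrow>
        if a \<in> D \<and> b \<in> D \<and> a \<otimes>\<^bsub>S\<^esub> b \<in> D then Some (a \<otimes>\<^bsub>S\<^esub> b) else None
    | _ \<Rightarrow> None)"

definition semigroup_on :: "'a set \<Rightarrow> ('a \<Rightarrow> 'a \<Rightarrow> 'a) \<Rightarrow> bool" where
  "semigroup_on A f \<longleftrightarrow> (\<forall>x\<in>A. \<forall>y\<in>A. f x y \<in> A) \<and>
     (\<forall>x\<in>A. \<forall>y\<in>A. \<forall>z\<in>A. f (f x y) z = f x (f y z))"

definition inverse_semigroup_on :: "'a set \<Rightarrow> ('a \<Rightarrow> 'a \<Rightarrow> 'a) \<Rightarrow> bool" where
  "inverse_semigroup_on A f \<longleftrightarrow> semigroup_on A f \<and>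
     (\<forall>a\<in>A. \<exists>!b. b \<in> A \<and> f (f a b) a = a \<and> f (f b a) b = b)"

section \<open>Well-definedness of the factorpower\<close>

lemma equiv_factor_rel: "equiv (nonempty_subsets G) (factor_rel G M \<phi>)"
  by (rule equivI) (auto simp: factor_rel_def refl_on_def sym_def trans_def)

context group_action
begin

lemma nonempty_set_mult:
  assumes "A \<in> nonempty_subsets G" "B \<in> nonempty_subsets G"
  shows "A <#> B \<in> nonempty_subsets G"
  using assms group_hom unfolding nonempty_subsets_def set_mult_def group_hom_def
  by (auto intro!: monoid.m_closed group.is_monoid)

lemma set_mult_action:
  assumes "A \<subseteq> carrier G" "B \<subseteq> carrier G" "m \<in> E"
  shows "{\<phi> c m | c. c \<in> A <#> B} = (\<Union>n\<in>{\<phi> b m | b. b \<in> B}. {\<phi> a n | a. a \<in> A})"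
proof -
  have "\<phi> (a \<otimes> b) m = \<phi> a (\<phi> b m)" if "a \<in> A" "b \<in> B" for a b
    using that assms composition_rule by blast
  then show ?thesis
    unfolding set_mult_def by (auto, metis+)
qed

lemma factor_rel_set_mult:
  assumes "(A, A') \<in> factor_rel G E \<phi>" "(B, B') \<in> factor_rel G E \<phi>"
  shows "(A <#> B, A' <#> B') \<in> factor_rel G E \<phi>"
proof -
  have ne: "A \<in> nonempty_subsets G" "A' \<in> nonempty_subsets G"
    "B \<in> nonempty_subsets G" "B' \<in> nonempty_subsets G"
    using assms by (auto simp: factor_rel_def)
  then have sub: "A \<subseteq> carrier G" "A' \<subseteq> carrier G" "B \<subseteq> carrier G" "B' \<subseteq> carrier G"
    by (auto simp: nonempty_subsets_def)
  have "{\<phi> c m | c. c \<in> A <#> B} = {\<phi> c m | c. c \<in> A' <#> B'}" if m: "m \<in> E" for m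
  proof -
    have B: "{\<phi> b m | b. b \<in> B} = {\<phi> b m | b. b \<in> B'}"
      using assms m by (auto simp: factor_rel_def)
    have in_E: "n \<in> E" if "n \<in> {\<phi> b m | b. b \<in> B'}" for n
      using that element_image m sub by blast
    have A: "{\<phi> a n | a. a \<in> A} = {\<phi> a n | a. a \<in> A'}" if "n \<in> E" for n
      using assms that by (auto simp: factor_rel_def)
    show ?thesis
      unfolding set_mult_action[OF sub(1,3) m] set_mult_action[OF sub(2,4) m] B
      using A[OF in_E] by (intro SUP_cong) auto
  qed
  then show ?thesis
    using ne nonempty_set_mult by (auto simp: factor_rel_def)
qed

lemma factor_class_mult:
  assumes "A \<in> nonempty_subsets G" "B \<in> nonempty_subsets G"
  shows "factor_class G E \<phi> A \<otimes>\<^bsub>factorpower G E \<phi>\<^esub> factor_class G E \<phi> B =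
    factor_class G E \<phi> (A <#> B)"
proof -
  have "factor_class G E \<phi> (A' <#> B') = factor_class G E \<phi> (A <#> B)"
    if "A' \<in> factor_class G E \<phi> A" "B' \<in> factor_class G E \<phi> B" for A' B'
    using that factor_rel_set_mult[of A A' B B']
    by (metis Image_singleton_iff equiv_class_eq equiv_factor_rel)
  moreover have "A \<in> factor_class G E \<phi> A" "B \<in> factor_class G E \<phi> B"
    using assms by (auto simp: factor_rel_def)
  ultimately show ?thesis
    unfolding factorpower_def monoid.simps by blast
qed

lemma monoid_factorpower: "monoid (factorpower G E \<phi>)"
proof -
  interpret group G using group_hom by (simp add: group_hom_def)
  let ?F = "factorpower G E \<phi>" and ?c = "factor_class G E \<phi>"
  have carr: "X \<in> carrier ?F \<longleftrightarrow> (\<exists>A\<in>nonempty_subsets G. X = ?c A)" for X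
    by (auto simp: factorpower_def quotient_def)
  have one: "\<one>\<^bsub>?F\<^esub> = ?c {\<one>}" "{\<one>} \<in> nonempty_subsets G"
    by (auto simp: factorpower_def nonempty_subsets_def)
  show ?thesis
  proof
    fix X Y assume "X \<in> carrier ?F" "Y \<in> carrier ?F"
    then show "X \<otimes>\<^bsub>?F\<^esub> Y \<in> carrier ?F"
      unfolding carr by (metis factor_class_mult nonempty_set_mult)
  next
    show "\<one>\<^bsub>?F\<^esub> \<in> carrier ?F"
      unfolding carr using one by blast
  next
    fix X Y Z assume "X \<in> carrier ?F" "Y \<in> carrier ?F" "Z \<in> carrier ?F"
    then obtain A B C where ABC: "A \<in> nonempty_subsets G" "B \<in> nonempty_subsets G"
      "C \<in> nonempty_subsets G" "X = ?c A" "Y = ?c B" "Z = ?c C"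
      unfolding carr by blast
    then have "A <#> B <#> C = A <#> (B <#> C)"
      by (intro set_mult_assoc) (auto simp: nonempty_subsets_def)
    with ABC show "X \<otimes>\<^bsub>?F\<^esub> Y \<otimes>\<^bsub>?F\<^esub> Z = X \<otimes>\<^bsub>?F\<^esub> (Y \<otimes>\<^bsub>?F\<^esub> Z)"
      by (simp add: factor_class_mult nonempty_set_mult)
  next
    fix X assume "X \<in> carrier ?F"
    then obtain A where A: "A \<in> nonempty_subsets G" "X = ?c A"
      unfolding carr by blast
    then have "A \<subseteq> carrier G" by (simp add: nonempty_subsets_def)
    then have "{\<one>} <#> A = A" "A <#> {\<one>} = A"
      by (force simp: set_mult_def)+
    with A one show "\<one>\<^bsub>?F\<^esub> \<otimes>\<^bsub>?F\<^esub> X = X" "X \<otimes>\<^bsub>?F\<^esub> \<one>\<^bsub>?F\<^esub> = X"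
      by (simp_all add: factor_class_mult)
  qed
qed

end

end

theory Submission
  imports Defs
begin

text \<open>Orbit-maximality of \<open>H\<close> means that every group element moving each point inside its
  \<open>H\<close>-orbit already lies in \<open>H\<close>. Hence each translate \<open>gHk\<close> is the largest set in its class, and
  cancelling in \<open>BCH \<sim> H\<close> shows that the \<open>\<D>\<close>-class of \<open>H\<close> consists of exactly the classes of the
  translates. A subgroup that is a translate of \<open>H\<close> is a conjugate of \<open>H\<close>, which gives (a). For (b),
  a product of translates \<open>A\<close>, \<open>B\<close> is again in the \<open>\<D>\<close>-class iff it has at most \<open>|H|\<close> elements, in
  which case \<open>AB = aB\<close> for each \<open>a \<in> A\<close>; and \<open>ABA = A\<close> forces \<open>B\<close> to lie in, so to be, the set of
  inverses of \<open>A\<close>.\<close>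

section \<open>Two-sided translates of a subgroup\<close>

text \<open>For a subgroup \<open>H\<close> these are exactly the right cosets of conjugates of
  \<open>H\<close>, since \<open>gHk\<close> equals \<open>gHg^-1\<close> times \<open>gk\<close>.
  The two-sided form makes stability under multiplication from either side and under inversion
  immediate.\<close>

definition translates :: "('g, 'c) monoid_scheme \<Rightarrow> 'g set \<Rightarrow> 'g set set" where
  "translates G H = {g <#\<^bsub>G\<^esub> H #>\<^bsub>G\<^esub> k | g k. g \<in> carrier G \<and> k \<in> carrier G}"

context group
begin

lemma inv_mult_cancel:
  assumes "x \<in> carrier G" "y \<in> carrier G"
  shows "inv x \<otimes> (x \<otimes> y) = y" "x \<otimes> (inv x \<otimes> y) = y"
  using assms by (simp_all flip: m_assoc)

lemma mem_translate: "x \<in> g <# H #> k \<longleftrightarrow> (\<exists>h\<in>H. x = g \<otimes> h \<otimes> k)"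
  by (auto simp: l_coset_def r_coset_def)

lemma translatesE:
  assumes "A \<in> translates G H"
  obtains g k where "g \<in> carrier G" "k \<in> carrier G" "A = g <# H #> k"
  using assms by (auto simp: translates_def)

section \<open>Stability of translates under multiplication by elements, and their size\<close>

lemma translates_l_coset:
  assumes "H \<subseteq> carrier G" "A \<in> translates G H" "x \<in> carrier G"
  shows "x <# A \<in> translates G H"
proof -
  obtain g k where gk: "g \<in> carrier G" "k \<in> carrier G" "A = g <# H #> k"
    using assms(2) by (rule translatesE)
  have "x <# A = (x \<otimes> g) <# H #> k"
    using assms gk by (force simp: l_coset_def r_coset_def m_assoc)
  then show ?thesis using assms gk by (auto simp: translates_def)
qed

lemma translates_r_coset:
  assumes "H \<subseteq> carrier G" "A \<in> translates G H" "x \<in> carrier G"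
  shows "A #> x \<in> translates G H"
proof -
  obtain g k where gk: "g \<in> carrier G" "k \<in> carrier G" "A = g <# H #> k"
    using assms(2) by (rule translatesE)
  have "A #> x = g <# H #> (k \<otimes> x)"
    using assms gk by (force simp: l_coset_def r_coset_def m_assoc)
  then show ?thesis using assms gk by (auto simp: translates_def)
qed

lemma subgroup_in_translates:
  assumes "H \<subseteq> carrier G"
  shows "H \<in> translates G H"
proof -
  have "H = \<one> <# H #> \<one>"
    using assms by (force simp: mem_translate)
  then show ?thesis by (auto simp: translates_def)
qed

lemma card_l_coset:
  assumes "A \<subseteq> carrier G" "x \<in> carrier G"
  shows "card (x <# A) = card A"
proof -
  have "x <# A = (\<lambda>a. x \<otimes> a) ` A" by (auto simp: l_coset_def)
  moreover have "inj_on (\<lambda>a. x \<otimes> a) A"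
    using assms inj_on_subset[OF inj_on_cmult] by blast
  ultimately show ?thesis by (simp add: card_image)
qed

lemma card_r_coset:
  assumes "A \<subseteq> carrier G" "x \<in> carrier G"
  shows "card (A #> x) = card A"
proof -
  have "A #> x = (\<lambda>a. a \<otimes> x) ` A" by (auto simp: r_coset_def)
  moreover have "inj_on (\<lambda>a. a \<otimes> x) A"
    using assms inj_on_subset[OF inj_on_multc] by blast
  ultimately show ?thesis by (simp add: card_image)
qed

lemma translates_subset:
  assumes "H \<subseteq> carrier G" "A \<in> translates G H"
  shows "A \<subseteq> carrier G"
  using assms by (auto elim!: translatesE simp: mem_translate intro!: m_closed)

lemma card_translates:
  assumes "H \<subseteq> carrier G" "A \<in> translates G H"
  shows "card A = card H"
  using assms by (auto elim!: translatesE simp: card_r_coset card_l_coset l_coset_subset_G)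

lemma translates_nonempty_subsets:
  assumes "subgroup H G" "A \<in> translates G H"
  shows "A \<in> nonempty_subsets G"
  using assms translates_subset[of H A] subgroup.subset[of H G] subgroup.one_closed[of H G]
  by (auto elim!: translatesE simp: nonempty_subsets_def l_coset_def r_coset_def)

section \<open>Inverses and products of translates, and translates that are subgroups\<close>

lemma translates_set_inv:
  assumes "subgroup H G" "A \<in> translates G H"
  shows "set_inv A \<in> translates G H"
proof -
  obtain g k where gk: "g \<in> carrier G" "k \<in> carrier G" "A = g <# H #> k"
    using assms(2) by (rule translatesE)
  have sub: "H \<subseteq> carrier G" using assms subgroup.subset by blast
  have "set_inv A = inv k <# H #> inv g"
  proof (intro Set.set_eqI iffI)
    fix x assume "x \<in> set_inv A"
    then obtain h where "h \<in> H" "x = inv (g \<otimes> h \<otimes> k)"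
      using gk by (auto simp: SET_INV_def mem_translate)
    then show "x \<in> inv k <# H #> inv g"
      using gk sub assms(1) subgroup.m_inv_closed
      by (force simp: mem_translate inv_mult_group m_assoc)
  next
    fix x assume "x \<in> inv k <# H #> inv g"
    then obtain h where h: "h \<in> H" "x = inv k \<otimes> h \<otimes> inv g"
      by (auto simp: mem_translate)
    then have "x = inv (g \<otimes> inv h \<otimes> k)"
      using gk sub by (auto simp: inv_mult_group m_assoc subset_iff)
    moreover have "g \<otimes> inv h \<otimes> k \<in> A"
      using subgroup.m_inv_closed[OF assms(1) h(1)] by (auto simp: gk mem_translate)
    ultimately show "x \<in> set_inv A" by (auto simp: SET_INV_def)
  qed
  then show ?thesis using gk by (auto simp: translates_def)
qed

text \<open>In a product of elements \<open>g h1 k\<close>, \<open>(g h2 k)^-1\<close>,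
  \<open>g h3 k\<close> the inner \<open>k\<close> and \<open>g\<close> cancel, leaving an element
  of \<open>H\<close> between the outer \<open>g\<close> and \<open>k\<close>. This supplies the
  inverse of the class of \<open>A\<close> in the trace.\<close>

lemma translates_mult_inv_mult:
  assumes "subgroup H G" "A \<in> translates G H"
  shows "A <#> set_inv A <#> A = A"
proof -
  obtain g k where gk: "g \<in> carrier G" "k \<in> carrier G" "A = g <# H #> k"
    using assms(2) by (rule translatesE)
  have sub: "H \<subseteq> carrier G" using assms subgroup.subset by blast
  show ?thesis
  proof (intro Set.set_eqI iffI)
    fix x assume "x \<in> A <#> set_inv A <#> A"
    then obtain h1 h2 h3 where h: "h1 \<in> H" "h2 \<in> H" "h3 \<in> H"
      "x = (g \<otimes> h1 \<otimes> k) \<otimes> inv (g \<otimes> h2 \<otimes> k) \<otimes> (g \<otimes> h3 \<otimes> k)"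
      by (auto simp: set_mult_def SET_INV_def gk mem_translate)
    then have c: "h1 \<in> carrier G" "h2 \<in> carrier G" "h3 \<in> carrier G" using sub by auto
    have "x = g \<otimes> (h1 \<otimes> inv h2 \<otimes> h3) \<otimes> k"
      unfolding h(4) using c gk(1,2)
      by (simp add: inv_mult_group m_assoc inv_mult_cancel)
    moreover have "h1 \<otimes> inv h2 \<otimes> h3 \<in> H"
      using h assms(1) by (simp add: subgroup.m_closed subgroup.m_inv_closed)
    ultimately show "x \<in> A" by (auto simp: gk mem_translate)
  next
    fix x assume x: "x \<in> A"
    then have "x \<in> carrier G" using translates_subset[OF sub assms(2)] by auto
    then have "x = x \<otimes> inv x \<otimes> x" by simp
    with x show "x \<in> A <#> set_inv A <#> A"
      by (auto simp: set_mult_def SET_INV_def)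
  qed
qed

text \<open>Putting \<open>b\<close> between two copies of the single element \<open>gk\<close> of
  \<open>A\<close> and cancelling the outer \<open>g\<close> and \<open>k\<close> shows that
  \<open>k b g\<close> lies in \<open>H\<close>. This inclusion is the source of uniqueness of
  inverses; equality will follow by counting when \<open>B\<close> is a translate.\<close>

lemma subset_set_inv_if_mult_mult_subset:
  assumes "subgroup H G" "A \<in> translates G H" "B \<subseteq> carrier G" "A <#> B <#> A \<subseteq> A"
  shows "B \<subseteq> set_inv A"
proof
  fix b assume b: "b \<in> B"
  obtain g k where gk: "g \<in> carrier G" "k \<in> carrier G" "A = g <# H #> k"
    using assms(2) by (rule translatesE)
  have sub: "H \<subseteq> carrier G" using assms subgroup.subset by blast
  have bc: "b \<in> carrier G" using b assms by auto
  have "g \<otimes> k \<in> A"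
    using gk subgroup.one_closed[OF assms(1)] by (auto simp: mem_translate intro!: bexI[of _ \<one>])
  then have "(g \<otimes> k) \<otimes> b \<otimes> (g \<otimes> k) \<in> A"
    using assms(4) b by (auto simp: set_mult_def)
  then obtain h where h: "h \<in> H" "(g \<otimes> k) \<otimes> b \<otimes> (g \<otimes> k) = g \<otimes> h \<otimes> k"
    by (auto simp: gk mem_translate)
  then have hc: "h \<in> carrier G" using sub by auto
  have "g \<otimes> ((k \<otimes> b \<otimes> g) \<otimes> k) = g \<otimes> (h \<otimes> k)"
    using h gk bc hc by (simp add: m_assoc)
  then have "k \<otimes> b \<otimes> g = h" using gk bc hc by simp
  then have "b = inv k \<otimes> h \<otimes> inv g"
    using gk bc hc by (auto simp: m_assoc inv_mult_cancel)
  then have "b = inv (g \<otimes> inv h \<otimes> k)"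
    using gk hc by (simp add: inv_mult_group m_assoc)
  moreover have "g \<otimes> inv h \<otimes> k \<in> A"
    using subgroup.m_inv_closed[OF assms(1) h(1)] by (auto simp: gk mem_translate)
  ultimately show "b \<in> set_inv A" by (auto simp: SET_INV_def)
qed

text \<open>For any \<open>a\<close> in \<open>A\<close>, the product contains
  \<open>a <# B\<close>, which already has \<open>card H\<close> elements. The size bound therefore
  forces equality, and a left multiple of \<open>B\<close> is again a translate.\<close>

lemma translates_set_mult:
  assumes "finite (carrier G)" "subgroup H G" "A \<in> translates G H" "B \<in> translates G H"
    and card: "card (A <#> B) \<le> card H"
  shows "A <#> B \<in> translates G H"
proof -
  have sub: "H \<subseteq> carrier G" using assms subgroup.subset by blast
  note AB = translates_subset[OF sub assms(3)] translates_subset[OF sub assms(4)]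
  obtain a where a: "a \<in> A" "a \<in> carrier G"
    using translates_nonempty_subsets[OF assms(2,3)] by (auto simp: nonempty_subsets_def)
  have fin: "finite (A <#> B)"
    using assms(1) setmult_subset_G[OF AB] finite_subset by blast
  have "a <# B = A <#> B"
    using a(1) card card_l_coset[OF AB(2) a(2)] card_translates[OF sub assms(4)]
    by (intro card_seteq[OF fin]) (auto simp: set_mult_def l_coset_def)
  then show ?thesis
    using translates_l_coset[OF sub assms(4) a(2)] by simp
qed

text \<open>The triple product contains copies of \<open>A <#> B\<close> and \<open>B <#> C\<close>,
  shifted by an element of \<open>C\<close> and of \<open>A\<close> respectively, so neither has
  more than \<open>card H\<close> elements. This is what makes the trace associative.\<close>

lemma translates_set_mult_factors:
  assumes "finite (carrier G)" "subgroup H G"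
    and ABC: "A \<in> translates G H" "B \<in> translates G H" "C \<in> translates G H"
    and mult: "A <#> B <#> C \<in> translates G H"
  shows "A <#> B \<in> translates G H" "B <#> C \<in> translates G H"
proof -
  have sub: "H \<subseteq> carrier G" using assms subgroup.subset by blast
  note S = translates_subset[OF sub ABC(1)] translates_subset[OF sub ABC(2)]
    translates_subset[OF sub ABC(3)]
  obtain a c where ac: "a \<in> A" "c \<in> C"
    using translates_nonempty_subsets[OF assms(2)] ABC by (fastforce simp: nonempty_subsets_def)
  have acc: "a \<in> carrier G" "c \<in> carrier G" using ac S by auto
  have fin: "finite (A <#> B <#> C)"
    using assms(1) S by (meson finite_subset setmult_subset_G)
  have m: "card (A <#> B <#> C) = card H" using card_translates[OF sub mult] .
  have "A <#> B #> c \<subseteq> A <#> B <#> C"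
    using ac by (auto simp: set_mult_def r_coset_def)
  then have "card (A <#> B) \<le> card H"
    using card_mono[OF fin] m card_r_coset[OF setmult_subset_G[OF S(1,2)] acc(2)] by metis
  then show "A <#> B \<in> translates G H" using translates_set_mult assms by blast
  have "a <# (B <#> C) \<subseteq> A <#> (B <#> C)"
    using ac by (auto simp: set_mult_def l_coset_def)
  then have "card (B <#> C) \<le> card H"
    using card_mono[OF fin] m card_l_coset[OF setmult_subset_G[OF S(2,3)] acc(1)]
      set_mult_assoc[OF S] by metis
  then show "B <#> C \<in> translates G H" using translates_set_mult assms by blast
qed

text \<open>Writing the identity of \<open>K\<close> as \<open>g h k\<close> gives
  \<open>k = inv h \<otimes> inv g\<close>, and \<open>H\<close> absorbs the factor
  \<open>inv h\<close>.\<close>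

lemma subgroup_translate_conjugate:
  assumes "subgroup H G" "subgroup K G" "K \<in> translates G H"
  shows "conjugate_subgroups G H K"
proof -
  obtain g k where gk: "g \<in> carrier G" "k \<in> carrier G" "K = g <# H #> k"
    using assms(3) by (rule translatesE)
  have sub: "H \<subseteq> carrier G" using assms subgroup.subset by blast
  obtain h where h: "h \<in> H" "\<one> = g \<otimes> h \<otimes> k"
    using subgroup.one_closed[OF assms(2)] gk by (auto simp: mem_translate)
  then have hc: "h \<in> carrier G" using sub by auto
  have k: "k = inv h \<otimes> inv g"
    using h(2) gk hc by (metis inv_mult_group inv_equality m_closed inv_inv inv_comm)
  have "K = g <# H #> inv h #> inv g"
    unfolding gk(3) k using gk hc sub by (simp add: coset_mult_assoc l_coset_subset_G)
  also have "g <# H #> inv h = g <# (H #> inv h)"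
    using gk hc sub by (force simp: l_coset_def r_coset_def m_assoc)
  also have "H #> inv h = H"
    using h assms(1) by (simp add: coset_join2 hc subgroup.m_inv_closed)
  finally show ?thesis using gk by (auto simp: conjugate_subgroups_def)
qed

end

section \<open>Inverse traces\<close>

context monoid
begin

section \<open>Green's relations as mutual divisibility\<close>

lemma green_L_iff:
  "(a, b) \<in> green_L G \<longleftrightarrow> a \<in> carrier G \<and> b \<in> carrier G \<and>
    (\<exists>x\<in>carrier G. a = x \<otimes> b) \<and> (\<exists>x\<in>carrier G. b = x \<otimes> a)"
proof -
  have sub: "{x \<otimes> a | x. x \<in> carrier G} \<subseteq> {x \<otimes> b | x. x \<in> carrier G} \<longleftrightarrow> (\<exists>x\<in>carrier G. a = x \<otimes> b)"
    if ab: "a \<in> carrier G" "b \<in> carrier G" for a b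
  proof
    assume "{x \<otimes> a | x. x \<in> carrier G} \<subseteq> {x \<otimes> b | x. x \<in> carrier G}"
    moreover have "a = \<one> \<otimes> a" using ab by simp
    ultimately show "\<exists>x\<in>carrier G. a = x \<otimes> b" by blast
  next
    assume "\<exists>x\<in>carrier G. a = x \<otimes> b"
    then show "{x \<otimes> a | x. x \<in> carrier G} \<subseteq> {x \<otimes> b | x. x \<in> carrier G}"
      using ab by (auto, metis m_assoc m_closed)
  qed
  show ?thesis
    using sub[of a b] sub[of b a] by (auto simp: green_L_def)
qed

lemma green_R_iff:
  "(a, b) \<in> green_R G \<longleftrightarrow> a \<in> carrier G \<and> b \<in> carrier G \<and>
    (\<exists>x\<in>carrier G. a = b \<otimes> x) \<and> (\<exists>x\<in>carrier G. b = a \<otimes> x)"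
proof -
  have sub: "{a \<otimes> x | x. x \<in> carrier G} \<subseteq> {b \<otimes> x | x. x \<in> carrier G} \<longleftrightarrow> (\<exists>x\<in>carrier G. a = b \<otimes> x)"
    if ab: "a \<in> carrier G" "b \<in> carrier G" for a b
  proof
    assume "{a \<otimes> x | x. x \<in> carrier G} \<subseteq> {b \<otimes> x | x. x \<in> carrier G}"
    moreover have "a = a \<otimes> \<one>" using ab by simp
    ultimately show "\<exists>x\<in>carrier G. a = b \<otimes> x" by blast
  next
    assume "\<exists>x\<in>carrier G. a = b \<otimes> x"
    then show "{a \<otimes> x | x. x \<in> carrier G} \<subseteq> {b \<otimes> x | x. x \<in> carrier G}"
      using ab by (auto, metis m_assoc m_closed)
  qed
  show ?thesis
    using sub[of a b] sub[of b a] by (auto simp: green_R_def)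
qed

text \<open>The condition \<open>factors\<close> says that a triple product in \<open>D\<close>
  never passes through the zero in either bracketing, which is associativity of the trace. In
  \<open>inverse\<close>, the element \<open>y\<close> is required to be unique already among the
  solutions of \<open>x z x = x\<close> in \<open>D\<close>.\<close>

lemma inverse_semigroup_on_trace:
  assumes D: "D \<subseteq> carrier G"
    and factors: "\<And>x y z. \<lbrakk>x \<in> D; y \<in> D; z \<in> D; x \<otimes> y \<otimes> z \<in> D\<rbrakk> \<Longrightarrow> x \<otimes> y \<in> D \<and> y \<otimes> z \<in> D"
    and inverse: "\<And>x. x \<in> D \<Longrightarrow>
      \<exists>y\<in>D. x \<otimes> y \<otimes> x = x \<and> y \<otimes> x \<otimes> y = y \<and> (\<forall>z\<in>D. x \<otimes> z \<otimes> x = x \<longrightarrow> z = y)"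
  shows "inverse_semigroup_on (trace_carrier D) (trace_mult G D)"
proof -
  let ?f = "trace_mult G D"
  have None [simp]: "?f None x = None" "?f x None = None" for x
    by (auto simp: trace_mult_def split: option.split)
  have Some_mult: "?f (Some a) (Some b) = (if a \<in> D \<and> b \<in> D \<and> a \<otimes> b \<in> D then Some (a \<otimes> b) else None)"
    for a b by (simp add: trace_mult_def)
  have assoc: "?f (?f (Some a) (Some b)) (Some c) = ?f (Some a) (?f (Some b) (Some c))"
    if abc: "a \<in> D" "b \<in> D" "c \<in> D" for a b c
  proof -
    have "a \<otimes> b \<otimes> c = a \<otimes> (b \<otimes> c)" using D abc by (auto intro: m_assoc)
    \<comment> \<open>If the triple product is outside \<open>D\<close>, both bracketings are zero;
      otherwise \<open>factors\<close> keeps both partial products in \<open>D\<close>.\<close>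
    with factors[OF abc] abc show ?thesis by (auto simp: Some_mult)
  qed
  have closed: "?f x y \<in> trace_carrier D" for x y
    by (cases x; cases y) (auto simp: Some_mult trace_carrier_def)
  have "semigroup_on (trace_carrier D) ?f"
    unfolding semigroup_on_def
  proof (intro conjI ballI closed)
    fix x y z assume "x \<in> trace_carrier D" "y \<in> trace_carrier D" "z \<in> trace_carrier D"
    then show "?f (?f x y) z = ?f x (?f y z)"
      by (cases x; cases y; cases z) (auto simp: trace_carrier_def assoc)
  qed
  moreover have "\<exists>!b. b \<in> trace_carrier D \<and> ?f (?f a b) a = a \<and> ?f (?f b a) b = b"
    if "a \<in> trace_carrier D" for a
  proof (cases a)
    case None
    \<comment> \<open>For the zero, the equation \<open>bab = b\<close> reads
      \<open>None = b\<close>, so the zero is its own only inverse.\<close>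
    then show ?thesis by (auto simp: trace_carrier_def)
  next
    case (Some x)
    then have x: "x \<in> D" using that by (auto simp: trace_carrier_def)
    obtain y where y: "y \<in> D" "x \<otimes> y \<otimes> x = x" "y \<otimes> x \<otimes> y = y"
      and uniq: "\<And>z. \<lbrakk>z \<in> D; x \<otimes> z \<otimes> x = x\<rbrakk> \<Longrightarrow> z = y"
      using inverse[OF x] by blast
    \<comment> \<open>Since \<open>x y x = x\<close> lies in \<open>D\<close>, the partial products
      do too, so the two equations persist in the trace without collapsing to zero.\<close>
    have "x \<otimes> y \<in> D" "y \<otimes> x \<in> D" using factors[of x y x] x y by auto
    then show ?thesis
      unfolding Some
    proof (intro ex1I[of _ "Some y"])
      fix b assume b: "b \<in> trace_carrier D \<and> ?f (?f (Some x) b) (Some x) = Some x \<and>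
        ?f (?f b (Some x)) b = b"
      then obtain z where "b = Some z" "z \<in> D"
        by (cases b) (auto simp: trace_carrier_def)
      with b show "b = Some y"
        by (auto simp: Some_mult split: if_splits intro: uniq)
    qed (use x y in \<open>auto simp: trace_mult_def trace_carrier_def\<close>)
  qed
  ultimately show ?thesis by (auto simp: inverse_semigroup_on_def)
qed

end

section \<open>The class of an orbit-maximal subgroup\<close>

context group_action
begin

sublocale group G
  using group_hom by (simp add: group_hom_def)

text \<open>The elements that move every point within its \<open>H\<close>-orbit form a subgroup
  \<open>K\<close> containing \<open>H\<close> with the same orbits, so maximality gives
  \<open>K = H\<close>.\<close>

lemma orbit_maximal_memI:
  assumes fin: "finite (carrier G)" and H: "orbit_maximal G E \<phi> H"
    and x: "x \<in> carrier G" "\<And>m. m \<in> E \<Longrightarrow> \<phi> x m \<in> {\<phi> h m | h. h \<in> H}"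
  shows "x \<in> H"
proof -
  have subgrp: "subgroup H G" using H by (simp add: orbit_maximal_def)
  have sub: "H \<subseteq> carrier G" using subgrp subgroup.subset by blast
  define K where "K = {x \<in> carrier G. \<forall>m\<in>E. \<phi> x m \<in> {\<phi> h m | h. h \<in> H}}"
  have HK: "H \<subseteq> K" using sub by (auto simp: K_def)
  have closed: "a \<otimes> b \<in> K" if "a \<in> K" "b \<in> K" for a b
  proof -
    have "\<exists>h\<in>H. \<phi> (a \<otimes> b) m = \<phi> h m" if m: "m \<in> E" for m
    proof -
      obtain h where h: "h \<in> H" "\<phi> b m = \<phi> h m" using \<open>b \<in> K\<close> m by (auto simp: K_def)
      then have "\<phi> h m \<in> E" using element_image m sub by blast
      then obtain h' where h': "h' \<in> H" "\<phi> a (\<phi> h m) = \<phi> h' (\<phi> h m)"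
        using \<open>a \<in> K\<close> by (auto simp: K_def)
      have "\<phi> (a \<otimes> b) m = \<phi> (h' \<otimes> h) m"
        using composition_rule[OF m] h h' that \<open>a \<in> K\<close> \<open>b \<in> K\<close> sub by (auto simp: K_def subset_iff)
      moreover have "h' \<otimes> h \<in> H" using subgroup.m_closed[OF subgrp h'(1) h(1)] .
      ultimately show ?thesis by blast
    qed
    moreover have "a \<otimes> b \<in> carrier G" using that by (auto simp: K_def)
    ultimately show ?thesis by (fastforce simp: K_def)
  qed
  have "subgroup K G"
  proof
    show "K \<subseteq> carrier G" by (auto simp: K_def)
    show "\<one> \<in> K" using HK subgrp subgroup.one_closed by blast
    fix a assume a: "a \<in> K"
    have ac: "a \<in> carrier G" using a by (auto simp: K_def)
    \<comment> \<open>Inverses come from finiteness: left multiplication by \<open>a\<close> is an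
      injective map of the finite set \<open>K\<close> to itself, hence hits the identity.\<close>
    have "inj_on (\<lambda>b. a \<otimes> b) K"
      using inj_on_subset[OF inj_on_cmult[OF ac]] by (auto simp: K_def)
    then have "(\<lambda>b. a \<otimes> b) ` K = K"
      using closed a fin \<open>K \<subseteq> carrier G\<close> by (intro endo_inj_surj) (auto intro: finite_subset)
    then obtain b where b: "b \<in> K" "a \<otimes> b = \<one>" using \<open>\<one> \<in> K\<close> by (metis imageE)
    then have "inv a = b" using ac \<open>K \<subseteq> carrier G\<close> inv_equality inv_comm by blast
    then show "inv a \<in> K" using b by simp
  qed (use closed in auto)
  moreover have "orbit_equivalent G E \<phi> H K"
  proof -
    \<comment> \<open>One inclusion of orbits is \<open>H \<subseteq> K\<close>, the other is the
      defining condition of \<open>K\<close>.\<close>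
    have "orbit (G\<lparr>carrier := H\<rparr>) \<phi> m = orbit (G\<lparr>carrier := K\<rparr>) \<phi> m" if "m \<in> E" for m
      using that HK by (auto simp: orbit_def K_def)
    then show ?thesis by (auto simp: orbit_equivalent_def orbits_def)
  qed
  ultimately have "K = H" using H HK by (auto simp: orbit_maximal_def)
  then show ?thesis using x by (auto simp: K_def)
qed

section \<open>Classes of translates in the factorpower\<close>

lemma factor_class_eq_iff:
  assumes "A \<in> nonempty_subsets G" "B \<in> nonempty_subsets G"
  shows "factor_class G E \<phi> A = factor_class G E \<phi> B \<longleftrightarrow> (A, B) \<in> factor_rel G E \<phi>"
  using assms equiv_factor_rel eq_equiv_class_iff by metis

lemma factorpower_carrierE:
  assumes "X \<in> carrier (factorpower G E \<phi>)"
  obtains A where "A \<in> nonempty_subsets G" "X = factor_class G E \<phi> A"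
  using assms by (auto simp: factorpower_def quotient_def)

lemma factor_class_closed:
  "A \<in> nonempty_subsets G \<Longrightarrow> factor_class G E \<phi> A \<in> carrier (factorpower G E \<phi>)"
  by (auto simp: factorpower_def quotient_def)

text \<open>Multiplying \<open>b\<close> by \<open>inv g\<close> and \<open>inv k\<close> reduces
  the claim to \<open>H\<close> itself, where it is \<open>orbit_maximal_memI\<close>. From here on,
  equations between classes can be turned into inclusions of sets.\<close>

lemma factor_rel_translate_subset:
  assumes fin: "finite (carrier G)" and H: "orbit_maximal G E \<phi> H"
    and A: "A \<in> translates G H" and rel: "(A, B) \<in> factor_rel G E \<phi>"
  shows "B \<subseteq> A"
proof
  fix b assume b: "b \<in> B"
  obtain g k where gk: "g \<in> carrier G" "k \<in> carrier G" "A = g <# H #> k"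
    using A by (rule translatesE)
  have sub: "H \<subseteq> carrier G" using H by (auto simp: orbit_maximal_def subgroup.subset)
  have bc: "b \<in> carrier G" using b rel by (auto simp: factor_rel_def nonempty_subsets_def)
  have "inv g \<otimes> b \<otimes> inv k \<in> H"
  proof (rule orbit_maximal_memI[OF fin H])
    fix m assume m: "m \<in> E"
    \<comment> \<open>In \<open>inv g \<otimes> b \<otimes> inv k\<close> the element
      \<open>b\<close> acts after \<open>inv k\<close>, so the relation between \<open>A\<close> and
      \<open>B\<close> is evaluated at this point.\<close>
    define n where "n = \<phi> (inv k) m"
    have n: "n \<in> E" using element_image gk m n_def by blast
    then have "\<phi> b n \<in> {\<phi> a n | a. a \<in> A}" using rel b by (auto simp: factor_rel_def)
    then obtain h where h: "h \<in> H" "\<phi> b n = \<phi> (g \<otimes> h \<otimes> k) n" by (auto simp: gk mem_translate)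
    have hc: "h \<in> carrier G" using h sub by auto
    have "\<phi> (inv g \<otimes> b \<otimes> inv k) m = \<phi> (inv g) (\<phi> b n)"
      using gk bc m n by (simp add: composition_rule n_def m_assoc)
    also have "\<dots> = \<phi> (inv g \<otimes> (g \<otimes> h \<otimes> k) \<otimes> inv k) m"
      using composition_rule[OF n, of "inv g" "g \<otimes> h \<otimes> k"]
        composition_rule[OF m, of "inv g \<otimes> (g \<otimes> h \<otimes> k)" "inv k"] gk hc h(2)
      by (simp add: n_def)
    also have "inv g \<otimes> (g \<otimes> h \<otimes> k) \<otimes> inv k = h"
      using gk hc by (simp add: m_assoc inv_mult_cancel)
    finally show "\<phi> (inv g \<otimes> b \<otimes> inv k) m \<in> {\<phi> h m | h. h \<in> H}" using h by auto
  qed (use gk bc in auto)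
  moreover have "b = g \<otimes> (inv g \<otimes> b \<otimes> inv k) \<otimes> k"
    using gk bc by (simp add: m_assoc inv_mult_cancel)
  ultimately show "b \<in> A" by (auto simp: gk mem_translate)
qed

text \<open>Both sets are the largest members of the same class. Two subgroups are allowed so that
  \<open>H'\<close>, as a translate of itself, can be compared with a translate of
  \<open>H\<close>.\<close>

lemma factor_class_translate_inj:
  assumes "finite (carrier G)" "orbit_maximal G E \<phi> H" "orbit_maximal G E \<phi> K"
    and "A \<in> translates G H" "B \<in> translates G K"
    and eq: "factor_class G E \<phi> A = factor_class G E \<phi> B"
  shows "A = B"
proof -
  have "A \<in> nonempty_subsets G" "B \<in> nonempty_subsets G"
    using assms translates_nonempty_subsets by (auto simp: orbit_maximal_def)
  then have "(A, B) \<in> factor_rel G E \<phi>" "(B, A) \<in> factor_rel G E \<phi>"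
    using eq factor_class_eq_iff by metis+
  then show ?thesis using factor_rel_translate_subset assms by (metis subset_antisym)
qed

text \<open>The L-step shows that the intermediate element is the class of a left coset of
  \<open>H\<close>, and the R-step that the end point is the class of a right multiple of that
  coset. Conversely, multiplying by the class of a one-element set is undone by the inverse
  element.\<close>

lemma D_class_orbit_maximal:
  assumes fin: "finite (carrier G)" and H: "orbit_maximal G E \<phi> H"
  shows "D_class (factorpower G E \<phi>) (factor_class G E \<phi> H) = factor_class G E \<phi> ` translates G H"
    (is "D_class ?F (?c H) = _")
proof -
  interpret F: monoid ?F by (rule monoid_factorpower)
  have subgrp: "subgroup H G" using H by (simp add: orbit_maximal_def)
  then have sub: "H \<subseteq> carrier G" using subgroup.subset by blast
  have one: "\<one> \<in> H" using subgrp subgroup.one_closed by blast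
  have Ht: "H \<in> translates G H" using sub by (rule subgroup_in_translates)
  note ne = translates_nonempty_subsets[OF subgrp]
  have sing: "{x} \<in> nonempty_subsets G" if "x \<in> carrier G" for x
    using that by (auto simp: nonempty_subsets_def)
  have lmult: "?c {x} \<otimes>\<^bsub>?F\<^esub> ?c A = ?c (x <# A)" if "x \<in> carrier G" "A \<in> translates G H" for x A
    using that ne sing by (simp add: factor_class_mult l_coset_eq_set_mult)
  have rmult: "?c A \<otimes>\<^bsub>?F\<^esub> ?c {x} = ?c (A #> x)" if "x \<in> carrier G" "A \<in> translates G H" for x A
    using that ne sing by (simp add: factor_class_mult r_coset_eq_set_mult)
  show ?thesis
  proof (intro Set.set_eqI iffI)
    fix X assume "X \<in> D_class ?F (?c H)"
    then obtain Y where Y: "(?c H, Y) \<in> green_L ?F" "(Y, X) \<in> green_R ?F"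
      by (auto simp: D_class_def green_D_def)
    obtain B C where B: "B \<in> nonempty_subsets G" "?c H = ?c B \<otimes>\<^bsub>?F\<^esub> Y"
      and C: "C \<in> nonempty_subsets G" "Y = ?c C \<otimes>\<^bsub>?F\<^esub> ?c H"
      using Y(1) unfolding F.green_L_iff by (metis factorpower_carrierE)
    have CH: "C <#> H \<in> nonempty_subsets G" "B <#> (C <#> H) \<in> nonempty_subsets G"
      using B C ne[OF Ht] nonempty_set_mult by auto
    have YC: "Y = ?c (C <#> H)" using C ne[OF Ht] by (simp add: factor_class_mult)
    then have "?c H = ?c (B <#> (C <#> H))" using B CH by (simp add: factor_class_mult)
    then have BCH: "B <#> (C <#> H) \<subseteq> H"
      using factor_rel_translate_subset[OF fin H Ht] factor_class_eq_iff CH ne[OF Ht] by blast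
    \<comment> \<open>One element of \<open>B\<close> suffices: cancelling \<open>b\<close> in
      \<open>BCH \<subseteq> H\<close> puts \<open>CH\<close> inside the coset of
      \<open>inv b\<close>.\<close>
    obtain b where b: "b \<in> B" "b \<in> carrier G" using B by (auto simp: nonempty_subsets_def)
    have Cc: "C \<subseteq> carrier G" "C \<noteq> {}" using C by (auto simp: nonempty_subsets_def)
    have "C <#> H = inv b <# H"
    proof
      show "C <#> H \<subseteq> inv b <# H"
      proof
        fix x assume x: "x \<in> C <#> H"
        then have "x \<in> carrier G" using CH by (auto simp: nonempty_subsets_def)
        then have "x = inv b \<otimes> (b \<otimes> x)" using b by (simp add: inv_mult_cancel)
        moreover have "b \<otimes> x \<in> H" using BCH b x by (auto simp: set_mult_def)
        ultimately show "x \<in> inv b <# H" by (auto simp: l_coset_def)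
      qed
      obtain c where c: "c \<in> C" "c \<in> carrier G" using Cc by auto
      \<comment> \<open>As \<open>H\<close> contains the identity, \<open>c\<close> itself lies in
        \<open>CH\<close>. Then \<open>inv b\<close> is \<open>c\<close> times the inverse of
        \<open>bc\<close>, so the two cosets of \<open>H\<close> agree.\<close>
      have bc: "b \<otimes> c \<in> H"
        using BCH b c one by (force simp: set_mult_def)
      show "inv b <# H \<subseteq> C <#> H"
      proof
        fix x assume "x \<in> inv b <# H"
        then obtain h where h: "h \<in> H" "x = inv b \<otimes> h" by (auto simp: l_coset_def)
        then have "x = c \<otimes> (inv (b \<otimes> c) \<otimes> h)"
          using b c sub by (auto simp: inv_mult_group m_assoc inv_mult_cancel subset_iff)
        moreover have "inv (b \<otimes> c) \<otimes> h \<in> H"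
          using bc h subgrp by (simp add: subgroup.m_closed subgroup.m_inv_closed)
        ultimately show "x \<in> C <#> H" using c by (auto simp: set_mult_def)
      qed
    qed
    define A where "A = inv b <# H"
    have A: "A \<in> translates G H" "Y = ?c A"
      using translates_l_coset[OF sub Ht] b YC \<open>C <#> H = inv b <# H\<close>
      by (auto simp: A_def)
    obtain P Q where P: "P \<in> nonempty_subsets G" "Y = X \<otimes>\<^bsub>?F\<^esub> ?c P"
      and Q: "Q \<in> nonempty_subsets G" "X = Y \<otimes>\<^bsub>?F\<^esub> ?c Q"
      using Y(2) unfolding F.green_R_iff by (metis factorpower_carrierE)
    have AQ: "A <#> Q \<in> nonempty_subsets G" "A <#> Q <#> P \<in> nonempty_subsets G"
      using P Q ne[OF A(1)] nonempty_set_mult by auto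
    have XQ: "X = ?c (A <#> Q)" using A Q ne[OF A(1)] by (simp add: factor_class_mult)
    then have "?c A = ?c (A <#> Q <#> P)" using A P AQ by (simp add: factor_class_mult)
    then have AQP: "A <#> Q <#> P \<subseteq> A"
      using factor_rel_translate_subset[OF fin H A(1)] factor_class_eq_iff AQ ne[OF A(1)] by blast
    have Ac: "A \<subseteq> carrier G" using translates_subset[OF sub A(1)] .
    obtain p where p: "p \<in> P" "p \<in> carrier G" using P by (auto simp: nonempty_subsets_def)
    obtain q where q: "q \<in> Q" "q \<in> carrier G" using Q by (auto simp: nonempty_subsets_def)
    have fin': "finite (A #> inv p)"
      using fin Ac p by (meson finite_subset inv_closed r_coset_subset_G)
    have sub1: "A <#> Q \<subseteq> A #> inv p"
    proof
      fix x assume x: "x \<in> A <#> Q"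
      then have "x \<in> carrier G" using AQ by (auto simp: nonempty_subsets_def)
      then have "x = (x \<otimes> p) \<otimes> inv p" using p by (simp add: m_assoc)
      moreover have "x \<otimes> p \<in> A" using AQP p x by (auto simp: set_mult_def)
      ultimately show "x \<in> A #> inv p" by (auto simp: r_coset_def)
    qed
    \<comment> \<open>\<open>A <#> Q\<close> is squeezed between \<open>A #> q\<close> and
      \<open>A #> inv p\<close>, which have equal finite size.\<close>
    have "A #> q \<subseteq> A <#> Q" using q by (auto simp: set_mult_def r_coset_def)
    then have "card (A #> q) \<le> card (A <#> Q)"
      using card_mono finite_subset[OF sub1 fin'] by blast
    then have "A <#> Q = A #> inv p"
      using card_seteq[OF fin' sub1] Ac p q by (simp add: card_r_coset)
    then show "X \<in> ?c ` translates G H"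
      using XQ translates_r_coset[OF sub A(1)] p by auto
  next
    fix X assume "X \<in> ?c ` translates G H"
    then obtain g k where gk: "g \<in> carrier G" "k \<in> carrier G" "X = ?c (g <# H #> k)"
      by (auto simp: translates_def)
    let ?A = "g <# H"
    have A: "?A \<in> translates G H" using translates_l_coset[OF sub Ht gk(1)] .
    have Ak: "?A #> k \<in> translates G H" using translates_r_coset[OF sub A gk(2)] .
    \<comment> \<open>The path from \<open>H\<close> to \<open>gHk\<close> goes through
      \<open>gH\<close>: the factor \<open>g\<close> is undone on the left, giving L, and
      \<open>k\<close> on the right, giving R.\<close>
    have "inv g <# ?A = H"
      using gk sub by (simp add: lcos_m_assoc lcos_mult_one)
    then have "(?c H, ?c ?A) \<in> green_L ?F"
      unfolding F.green_L_iff
      using lmult[OF gk(1) Ht] lmult[OF inv_closed[OF gk(1)] A] gk factor_class_closed ne Ht A sing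
      by (metis inv_closed)
    moreover have "?A #> k #> inv k = ?A"
      using gk sub by (simp add: coset_mult_assoc l_coset_subset_G)
    then have "(?c ?A, X) \<in> green_R ?F"
      unfolding F.green_R_iff gk(3)
      using rmult[OF gk(2) A] rmult[OF inv_closed[OF gk(2)] Ak] gk factor_class_closed ne Ak A sing
      by (metis inv_closed)
    ultimately show "X \<in> D_class ?F (?c H)"
      by (auto simp: D_class_def green_D_def)
  qed
qed

text \<open>Injectivity on translates turns membership of the class into membership of
  \<open>H'\<close> in \<open>translates G H\<close>. A conjugate is the translate with
  \<open>k = inv g\<close>, and a subgroup among the translates is a conjugate.\<close>

lemma factor_class_in_D_class_iff_conjugate:
  assumes fin: "finite (carrier G)" and H: "orbit_maximal G E \<phi> H" and H': "orbit_maximal G E \<phi> H'"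
  shows "factor_class G E \<phi> H' \<in> D_class (factorpower G E \<phi>) (factor_class G E \<phi> H) \<longleftrightarrow>
    conjugate_subgroups G H H'"
proof -
  have subgrp: "subgroup H G" "subgroup H' G" using H H' by (simp_all add: orbit_maximal_def)
  have "factor_class G E \<phi> H' \<in> factor_class G E \<phi> ` translates G H \<longleftrightarrow> H' \<in> translates G H"
    using factor_class_translate_inj[OF fin H H' _ subgroup_in_translates]
      subgroup.subset[OF subgrp(2)] by auto
  also have "\<dots> \<longleftrightarrow> conjugate_subgroups G H H'"
    using subgroup_translate_conjugate[OF subgrp]
    by (auto simp: conjugate_subgroups_def translates_def)
  finally show ?thesis using D_class_orbit_maximal[OF fin H] by simp
qed

text \<open>The criterion for traces applies once products of classes are computed with translates
  as representatives; the inverse of the class of \<open>A\<close> is the class of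
  \<open>set_inv A\<close>.\<close>

lemma inverse_trace_orbit_maximal:
  assumes fin: "finite (carrier G)" and H: "orbit_maximal G E \<phi> H"
  defines "F \<equiv> factorpower G E \<phi>"
  defines "D \<equiv> D_class F (factor_class G E \<phi> H)"
  shows "inverse_semigroup_on (trace_carrier D) (trace_mult F D)"
proof -
  interpret F: monoid F unfolding F_def by (rule monoid_factorpower)
  let ?c = "factor_class G E \<phi>" and ?T = "translates G H"
  have subgrp: "subgroup H G" using H by (simp add: orbit_maximal_def)
  then have sub: "H \<subseteq> carrier G" using subgroup.subset by blast
  have D: "D = ?c ` ?T" unfolding D_def F_def using D_class_orbit_maximal[OF fin H] .
  note ne = translates_nonempty_subsets[OF subgrp]
  have fin_sub: "finite A" if "A \<in> ?T" for A
    using that fin translates_subset[OF sub] finite_subset by blast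
  have mult: "?c A \<otimes>\<^bsub>F\<^esub> ?c B = ?c (A <#> B)"
    if "A \<in> nonempty_subsets G" "B \<in> nonempty_subsets G" for A B
    using that factor_class_mult by (simp add: F_def)
  have mult3: "?c A \<otimes>\<^bsub>F\<^esub> ?c B \<otimes>\<^bsub>F\<^esub> ?c C = ?c (A <#> B <#> C)"
    if "A \<in> ?T" "B \<in> ?T" "C \<in> ?T" for A B C
    using that ne by (simp add: mult nonempty_set_mult)
  show ?thesis
  proof (rule F.inverse_semigroup_on_trace)
    show "D \<subseteq> carrier F" unfolding D F_def using ne factor_class_closed by blast
  next
    fix x y z assume xyz: "x \<in> D" "y \<in> D" "z \<in> D" "x \<otimes>\<^bsub>F\<^esub> y \<otimes>\<^bsub>F\<^esub> z \<in> D"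
    then obtain A B C where A: "A \<in> ?T" "x = ?c A" and B: "B \<in> ?T" "y = ?c B"
      and C: "C \<in> ?T" "z = ?c C" by (auto simp: D)
    obtain T where T: "T \<in> ?T" "?c (A <#> B <#> C) = ?c T"
      using xyz mult3 A B C by (auto simp: D)
    have ABC: "A <#> B <#> C \<in> nonempty_subsets G"
      using A B C ne nonempty_set_mult by auto
    then have "(T, A <#> B <#> C) \<in> factor_rel G E \<phi>"
      using T ne factor_class_eq_iff by metis
    then have "A <#> B <#> C \<subseteq> T" using factor_rel_translate_subset[OF fin H T(1)] by blast
    \<comment> \<open>So far the triple product only shares its class with the translate
      \<open>T\<close>. It equals \<open>T\<close>, because it lies between \<open>a <# C\<close>
      and \<open>T\<close>, which have the same size.\<close>
    moreover obtain a where a: "a \<in> A <#> B" "a \<in> carrier G"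
      using A B ne nonempty_set_mult[of A B] by (auto simp: nonempty_subsets_def)
    then have "a <# C \<subseteq> A <#> B <#> C" by (auto simp: set_mult_def l_coset_def)
    moreover have "a <# C = T"
      using calculation a T C sub translates_l_coset[OF sub C(1) a(2)]
      by (intro card_seteq fin_sub) (auto simp: card_translates)
    ultimately have "A <#> B <#> C \<in> ?T" using T by (metis subset_antisym)
    then have "A <#> B \<in> ?T" "B <#> C \<in> ?T"
      using translates_set_mult_factors[OF fin subgrp A(1) B(1) C(1)] by auto
    then show "x \<otimes>\<^bsub>F\<^esub> y \<in> D \<and> y \<otimes>\<^bsub>F\<^esub> z \<in> D"
      using A B C ne mult by (auto simp: D)
  next
    fix x assume "x \<in> D"
    then obtain A where A: "A \<in> ?T" "x = ?c A" by (auto simp: D)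
    let ?B = "set_inv A"
    have B: "?B \<in> ?T" using translates_set_inv[OF subgrp A(1)] .
    \<comment> \<open>With this, the second inverse law is the first one applied to
      \<open>set_inv A\<close>.\<close>
    have BB: "set_inv ?B = A"
      using translates_subset[OF sub A(1)] by (force simp: SET_INV_def)
    show "\<exists>y\<in>D. x \<otimes>\<^bsub>F\<^esub> y \<otimes>\<^bsub>F\<^esub> x = x \<and> y \<otimes>\<^bsub>F\<^esub> x \<otimes>\<^bsub>F\<^esub> y = y \<and>
        (\<forall>z\<in>D. x \<otimes>\<^bsub>F\<^esub> z \<otimes>\<^bsub>F\<^esub> x = x \<longrightarrow> z = y)"
    proof (intro bexI[of _ "?c ?B"] conjI ballI impI)
      show "x \<otimes>\<^bsub>F\<^esub> ?c ?B \<otimes>\<^bsub>F\<^esub> x = x"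
        using A B mult3 translates_mult_inv_mult[OF subgrp A(1)] by simp
      show "?c ?B \<otimes>\<^bsub>F\<^esub> x \<otimes>\<^bsub>F\<^esub> ?c ?B = ?c ?B"
        using A B mult3 translates_mult_inv_mult[OF subgrp B] BB by simp
      show "?c ?B \<in> D" using B by (auto simp: D)
    next
      fix z assume z: "z \<in> D" "x \<otimes>\<^bsub>F\<^esub> z \<otimes>\<^bsub>F\<^esub> x = x"
      then obtain C where C: "C \<in> ?T" "z = ?c C" by (auto simp: D)
      have "?c (A <#> C <#> A) = ?c A" using z A C mult3 by simp
      moreover have "A <#> C <#> A \<in> nonempty_subsets G"
        using A C ne nonempty_set_mult by auto
      ultimately have "(A, A <#> C <#> A) \<in> factor_rel G E \<phi>"
        using A ne factor_class_eq_iff by metis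
      then have "A <#> C <#> A \<subseteq> A" using factor_rel_translate_subset[OF fin H A(1)] by blast
      then have "C \<subseteq> ?B"
        using subset_set_inv_if_mult_mult_subset[OF subgrp A(1)] translates_subset[OF sub C(1)] by blast
      \<comment> \<open>Both are translates of \<open>H\<close>, so the inclusion between sets of
        equal finite size is an equality.\<close>
      then have "C = ?B"
        using B C sub by (intro card_seteq fin_sub) (auto simp: card_translates)
      then show "z = ?c ?B" using C by simp
    qed
  qed
qed

end

theorem proposition5:
  fixes G :: "('g, 'c) monoid_scheme"
    and M :: "'m set"
    and \<phi> :: "'g \<Rightarrow> 'm \<Rightarrow> 'm"
    and H H' :: "'g set"
  assumes "group_action G M \<phi>"
    and "finite (carrier G)"
    and "finite M"
    and "orbit_maximal G M \<phi> H"
    and "orbit_maximal G M \<phi> H'"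
  defines "FP \<equiv> factorpower G M \<phi>"
  defines "D\<^sub>H \<equiv> D_class FP (factor_class G M \<phi> H)"
  shows "(factor_class G M \<phi> H' \<in> D\<^sub>H \<longleftrightarrow> conjugate_subgroups G H H') \<and>
    inverse_semigroup_on (trace_carrier D\<^sub>H) (trace_mult FP D\<^sub>H)"
  using group_action.factor_class_in_D_class_iff_conjugate[OF assms(1,2,4,5)]
    group_action.inverse_trace_orbit_maximal[OF assms(1,2,4)]
  unfolding FP_def D\<^sub>H_def by blast

end
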